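(* Let $A,B\in su(1,1)$ and consider the control system $\dot X(t)=[A+u(t)B]X(t)$, $X(0)=I_2$, with real control $u$, on the group $SU(1,1)$, together with the cost $J(u)=\int_0^T u(t)^2\,dt$. Assume the system is controllable on $SU(1,1)$. If $\langle B,B^{\dagger}\rangle\neq 0$, then the control function $u(t)=-\langle A,B^{\dagger}\rangle/\langle B,B^{\dagger}\rangle$ (a.e.) is the only abnormal extremal for this optimal control problem, i.e. every abnormal extremal control $u$ satisfies $u(t)=-\langle A,B^{\dagger}\rangle/\langle B,B^{\dagger}\rangle$ for almost every $t$. If $\langle B,B^{\dagger}\rangle=0$, then there is no abnormal extremal.
   Context: $su(1,1)$ is the real Lie algebra spanned by $K_x=\frac12\begin{pmatrix}0&-i\\ i&0\end{pmatrix}$, $K_y=\frac12\begin{pmatrix}0&-1\\-1&0\end{pmatrix}$, $K_z=\frac12\begin{pmatrix}-i&0\\0&i\end{pmatrix}$, and $SU(1,1)$ is the corresponding connected Lie group of $2\times2$ special pseudo-unitary matrices. Inner product: $\langle M,N\rangle=2\,\mathrm{Tr}(MN^{\dagger})$, $N^{\dagger}$ the conjugate transpose. Controls are real-valued (measurable, locally integrable) functions of time, and $X(t)$ denotes the corresponding absolutely continuous solution. The system is controllable on $SU(1,1)$ if for every $X_f\in SU(1,1)$ there exist a control $u$ and a time $T\ge 0$ with $X(T)=X_f$. An abnormal extremal is a control $u$ on $[0,T]$ with trajectory $X$ for which there exists a nonzero constant matrix $S\in su(1,1)$ such that for almost every $t$ the function $v\mapsto \langle S, X(t)^{-1}[A+vB]X(t)\rangle$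 is minimized over $v\in\mathbb{R}$ at $v=u(t)$ (this is the maximum principle condition with Hamiltonian $\langle S,X^{-1}[A+uB]X\rangle+\frac12\lambda_0u^2$ and multiplier $\lambda_0=0$). *)

theory Defs
  imports "HOL-Analysis.Analysis"
begin

type_synonym cmat = "complex^2^2"

definition mat2 :: "complex \<Rightarrow> complex \<Rightarrow> complex \<Rightarrow> complex \<Rightarrow> cmat" where
  "mat2 a b c d = vector [vector [a, b], vector [c, d]]"

definition Kx :: cmat where "Kx = mat2 0 (-\<i>/2) (\<i>/2) 0"
definition Ky :: cmat where "Ky = mat2 0 (-1/2) (-1/2) 0"
definition Kz :: cmat where "Kz = mat2 (-\<i>/2) 0 0 (\<i>/2)"

definition adj :: "cmat \<Rightarrow> cmat" where
  "adj M = (\<chi> i j. cnj (M $ j $ i))"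

definition su11 :: "cmat set" where
  "su11 = {M. \<exists>a b c :: real. M = a *\<^sub>R Kx + b *\<^sub>R Ky + c *\<^sub>R Kz}"

definition Jm :: cmat where "Jm = mat2 1 0 0 (-1)"

definition SU11 :: "cmat set" where
  "SU11 = {X. adj X ** Jm ** X = Jm \<and> det X = 1}"

definition ip :: "cmat \<Rightarrow> cmat \<Rightarrow> complex" where
  "ip M N = 2 * trace (M ** adj N)"

definition admissible :: "(real \<Rightarrow> real) \<Rightarrow> real \<Rightarrow> bool" where
  "admissible u T \<longleftrightarrow> set_integrable lborel {0..T} u"

text \<open>X is the (absolutely continuous, Caratheodory) solution of
  dX/dt = (A + u B) X, X(0) = I on [0,T], written in integral form.\<close>
definition trajectory :: "cmat \<Rightarrow> cmat \<Rightarrow> (real \<Rightarrow> real) \<Rightarrow> real \<Rightarrow> (real \<Rightarrow> cmat) \<Rightarrow> bool" where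
  "trajectory A B u T X \<longleftrightarrow>
     continuous_on {0..T} X \<and>
     set_integrable lborel {0..T} (\<lambda>s. (A + u s *\<^sub>R B) ** X s) \<and>
     (\<forall>t\<in>{0..T}. X t = mat 1 + (LINT s:{0..t}|lborel. (A + u s *\<^sub>R B) ** X s))"

definition controllable :: "cmat \<Rightarrow> cmat \<Rightarrow> bool" where
  "controllable A B \<longleftrightarrow>
     (\<forall>Xf\<in>SU11. \<exists>u T X. T \<ge> 0 \<and> admissible u T \<and> trajectory A B u T X \<and> X T = Xf)"

text \<open>Abnormal extremal (maximum principle with lambda_0 = 0).  The values
  <S, X^-1 (A + v B) X> are real for S, A, B in su(1,1); we compare real parts.\<close>
definition abnormal_extremal :: "cmat \<Rightarrow> cmat \<Rightarrow> (real \<Rightarrow> real) \<Rightarrow> real \<Rightarrow> (real \<Rightarrow> cmat) \<Rightarrow> bool" where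
  "abnormal_extremal A B u T X \<longleftrightarrow>
     T > 0 \<and> admissible u T \<and> trajectory A B u T X \<and>
     (\<exists>S\<in>su11. S \<noteq> 0 \<and>
        (AE t in lborel. t \<in> {0..T} \<longrightarrow>
           (\<forall>v::real. Re (ip S (matrix_inv (X t) ** (A + u t *\<^sub>R B) ** X t))
                      \<le> Re (ip S (matrix_inv (X t) ** (A + v *\<^sub>R B) ** X t)))))"

end

(* Along a trajectory, (X^-1 N X)' = X^-1 [N, A + u B] X for every constant N. An abnormal multiplier
   S gives M = X S^* X^-1 with tr(M B) = 0 a.e., hence everywhere by continuity. Differentiating
   once gives tr(M C) = 0 with C = [A,B], and once more tr(M [C, A + u B]) = 0 a.e. Since
   [[A,B],Z] = 2 tr(BZ) A - 2 tr(AZ) B, the last condition reads tr(B (A + u B)) tr(M A) = 0.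
   Controllability forces tr(C C) to be nonzero, so A, B, C form a basis and tr(M A) = 0 would
   give M = 0; hence tr(BA) + u tr(BB) = 0 a.e. If tr(BB) = 0, then tr(BA) = 0 as well and
   tr(C C) = 2 tr(AB)^2 - 2 tr(AA) tr(BB) = 0, a contradiction. *)
theory Submission
  imports Defs
begin

section \<open>Primitives of Lebesgue integrable functions\<close>

text \<open>Absolute continuity in integral form: \<open>f'\<close> is the derivative of
  \<open>f\<close> almost everywhere. This matches the integral equation in
  \<open>trajectory\<close>, and calculus with it reduces to calculus with integrals.\<close>

definition primitive_on ::
  "real \<Rightarrow> (real \<Rightarrow> 'a::{banach, second_countable_topology}) \<Rightarrow> (real \<Rightarrow> 'a) \<Rightarrow> bool" where
  "primitive_on T f f' \<longleftrightarrow> set_integrable lborel {0..T} f' \<and>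
     (\<forall>t\<in>{0..T}. f t = f 0 + (LINT s:{0..t}|lborel. f' s))"

lemma primitive_onD:
  assumes "primitive_on T f f'" "0 \<le> t" "t \<le> T"
  shows "f t = f 0 + (LINT s:{0..t}|lborel. f' s)"
  using assms unfolding primitive_on_def by (meson atLeastAtMost_iff)

lemma primitive_on_cong:
  assumes "primitive_on T f f'"
    and "\<And>t. t \<in> {0..T} \<Longrightarrow> f t = g t" "\<And>t. t \<in> {0..T} \<Longrightarrow> f' t = g' t"
  shows "primitive_on T g g'"
  unfolding primitive_on_def
proof (intro conjI ballI)
  have "set_integrable lborel {0..T} f' = set_integrable lborel {0..T} g'"
    by (rule set_integrable_cong) (use assms(3) in auto)
  then show "set_integrable lborel {0..T} g'"
    using assms(1) unfolding primitive_on_def by (rule iffD1[OF _ conjunct1])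
  fix t assume t: "t \<in> {0..T}"
  have "g t = f t" "f 0 = g 0"
    by (rule assms(2)[symmetric] assms(2), use t in simp)+
  moreover have "f t = f 0 + (LINT s:{0..t}|lborel. f' s)"
    by (rule primitive_onD[OF assms(1)]) (use t in auto)
  moreover have "(LINT s:{0..t}|lborel. f' s) = (LINT s:{0..t}|lborel. g' s)"
    by (rule set_lebesgue_integral_cong) (use t in \<open>auto intro!: assms(3)\<close>)
  ultimately show "g t = g 0 + (LINT s:{0..t}|lborel. g' s)"
    by simp
qed

lemma primitive_on_bounded_linear:
  assumes L: "bounded_linear L" and f: "primitive_on T f f'"
  shows "primitive_on T (\<lambda>t. L (f t)) (\<lambda>t. L (f' t))"
  unfolding primitive_on_def
proof (intro conjI ballI)
  interpret bounded_linear L by fact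
  have int: "set_integrable lborel {0..T} f'" using f by (simp add: primitive_on_def)
  show "set_integrable lborel {0..T} (\<lambda>t. L (f' t))"
    using integrable_bounded_linear[OF L int[unfolded set_integrable_def]]
    by (simp add: set_integrable_def scaleR)
  fix t assume t: "t \<in> {0..T}"
  have "set_integrable lborel {0..t} f'"
    using t by (intro set_integrable_subset[OF int]) auto
  then have "L (LINT s:{0..t}|lborel. f' s) = (LINT s:{0..t}|lborel. L (f' s))"
    unfolding set_lebesgue_integral_def set_integrable_def
    by (subst integral_bounded_linear[OF L, symmetric]) (auto simp: scaleR)
  then show "L (f t) = L (f 0) + (LINT s:{0..t}|lborel. L (f' s))"
    using primitive_onD[OF f, of t] t by (auto simp: add)
qed

text \<open>Fubini for the product of the two derivatives on the square with side
  \<open>{0..t}\<close>, split along the diagonal.\<close>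

lemma primitive_on_bilinear:
  fixes f f' :: "real \<Rightarrow> 'a::euclidean_space" and g g' :: "real \<Rightarrow> 'b::euclidean_space"
    and pr :: "'a \<Rightarrow> 'b \<Rightarrow> 'c::euclidean_space"
  assumes pr: "bounded_bilinear pr" and f: "primitive_on T f f'" and g: "primitive_on T g g'"
  shows "primitive_on T (\<lambda>t. pr (f t) (g t)) (\<lambda>t. pr (f' t) (g t) + pr (f t) (g' t))"
proof -
  interpret bounded_bilinear pr by fact
  \<comment> \<open>Integrability and formula come from one decomposition, so they are proved
    together for each \<open>t\<close>; \<open>t = T\<close> later yields integrability on the whole
    interval.\<close>
  have key: "integrable lborel (\<lambda>s. indicator {0..t} s *\<^sub>R (pr (f' s) (g s) + pr (f s) (g' s)))
     \<and> pr (f t) (g t) = pr (f 0) (g 0) + (LINT s:{0..t}|lborel. pr (f' s) (g s) + pr (f s) (g' s))"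
    if t: "0 \<le> t" "t \<le> T" for t
  proof -
    define a where "a s = indicator {0..t} s *\<^sub>R f' s" for s
    define b where "b s = indicator {0..t} s *\<^sub>R g' s" for s
    have a: "integrable lborel a" and b: "integrable lborel b"
      using f g t set_integrable_subset[of lborel "{0..T}" f' "{0..t}"]
        set_integrable_subset[of lborel "{0..T}" g' "{0..t}"]
      by (auto simp: primitive_on_def set_integrable_def a_def[abs_def] b_def[abs_def])
    note [measurable] = borel_measurable_integrable[OF a] borel_measurable_integrable[OF b]
    have cont: "(\<lambda>x. pr (fst x) (snd x)) \<in> borel_measurable borel"
      by (intro borel_measurable_continuous_onI continuous_intros continuous_on)
    have m: "(\<lambda>x. pr (a (fst x)) (b (snd x))) \<in> borel_measurable (lborel \<Otimes>\<^sub>M lborel)"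
    proof -
      have "(\<lambda>x. (a (fst x), b (snd x))) \<in> borel_measurable (lborel \<Otimes>\<^sub>M lborel)"
        by measurable
      from measurable_compose[OF this cont] show ?thesis by simp
    qed
    obtain K where K: "\<And>x y. norm (pr x y) \<le> norm x * norm y * K" using bounded by blast
    \<comment> \<open>The product of the norms is integrable on the plane and, up to the factor
      \<open>K\<close>, dominates the bilinear product.\<close>
    have ab: "integrable (lborel \<Otimes>\<^sub>M lborel) (\<lambda>x. norm (a (fst x)) * norm (b (snd x)))"
    proof (rule lborel_pair.Fubini_integrable)
      show "(\<lambda>x. norm (a (fst x)) * norm (b (snd x))) \<in> borel_measurable (lborel \<Otimes>\<^sub>M lborel)"
        by measurable
    qed (use a b in \<open>simp_all add: abs_mult\<close>)
    have h: "integrable (lborel \<Otimes>\<^sub>M lborel) (\<lambda>x. pr (a (fst x)) (b (snd x)))"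
    proof (rule Bochner_Integration.integrable_bound)
      show "integrable (lborel \<Otimes>\<^sub>M lborel) (\<lambda>x. norm (a (fst x)) * norm (b (snd x)) * K)"
        using ab by simp
      show "AE x in lborel \<Otimes>\<^sub>M lborel. norm (pr (a (fst x)) (b (snd x)))
              \<le> norm (norm (a (fst x)) * norm (b (snd x)) * K)"
        using order_trans[OF K abs_ge_self] by (intro AE_I2) simp
    qed (rule m)
    \<comment> \<open>On the half \<open>s \<le> r\<close> the integral over \<open>s\<close> is
      taken first and produces \<open>f r - f 0\<close>; on the half \<open>r < s\<close> the
      integral over \<open>r\<close> is taken first and produces \<open>g s - g 0\<close>.\<close>
    define p where "p = (\<lambda>s r. indicator {(s::real, r). s \<le> r} (s, r) *\<^sub>R pr (a s) (b r))"
    define q where "q = (\<lambda>s r. indicator {(s::real, r). r < s} (s, r) *\<^sub>R pr (a s) (b r))"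
    have "{x \<in> space (lborel \<Otimes>\<^sub>M lborel). (fst x::real) \<le> snd x} \<in> sets (lborel \<Otimes>\<^sub>M lborel)"
      "{x \<in> space (lborel \<Otimes>\<^sub>M lborel). (snd x::real) < fst x} \<in> sets (lborel \<Otimes>\<^sub>M lborel)"
      by measurable
    then have S: "{(s::real, r::real). s \<le> r} \<in> sets (lborel \<Otimes>\<^sub>M lborel)"
      "{(s::real, r::real). r < s} \<in> sets (lborel \<Otimes>\<^sub>M lborel)"
      by (simp_all add: space_pair_measure case_prod_beta')
    have p: "integrable (lborel \<Otimes>\<^sub>M lborel) (case_prod p)"
      using integrable_mult_indicator[OF S(1) h] by (simp add: p_def case_prod_beta')
    have q: "integrable (lborel \<Otimes>\<^sub>M lborel) (case_prod q)"
      using integrable_mult_indicator[OF S(2) h] by (simp add: q_def case_prod_beta')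
    have pint: "(LINT s|lborel. p s r) = indicator {0..t} r *\<^sub>R pr (f r - f 0) (g' r)" for r
    proof (cases "r \<in> {0..t}")
      case True
      have "(LINT s|lborel. p s r) = (LINT s|lborel. pr (indicator {0..r} s *\<^sub>R f' s) (g' r))"
        using True by (intro Bochner_Integration.integral_cong)
          (auto simp: p_def a_def b_def indicator_def zero_left)
      also have "\<dots> = pr (LINT s:{0..r}|lborel. f' s) (g' r)"
        unfolding set_lebesgue_integral_def
      proof (rule integral_bounded_linear[OF bounded_linear_left])
        show "integrable lborel (\<lambda>s. indicator {0..r} s *\<^sub>R f' s)"
          using f t True set_integrable_subset[of lborel "{0..T}" f' "{0..r}"]
          by (auto simp: primitive_on_def set_integrable_def)
      qed
      finally show ?thesis using True t primitive_onD[OF f, of r] by simp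
    next
      case False
      then show ?thesis by (auto simp: p_def b_def zero_right)
    qed
    have qint: "(LINT r|lborel. q s r) = indicator {0..t} s *\<^sub>R pr (f' s) (g s - g 0)" for s
    proof (cases "s \<in> {0..t}")
      case True
      have int: "integrable lborel (\<lambda>r. indicator {0..s} r *\<^sub>R g' r)"
          using g t True set_integrable_subset[of lborel "{0..T}" g' "{0..s}"]
          by (auto simp: primitive_on_def set_integrable_def)
      \<comment> \<open>The strict inequality in \<open>q\<close> leaves out the point
        \<open>r = s\<close>, which \<open>{0..s}\<close> contains; a single point does not affect
        the integral.\<close>
      have "(LINT r|lborel. q s r) = (LINT r|lborel. pr (f' s) (indicator {0..s} r *\<^sub>R g' r))"
      proof (rule integral_discrete_difference[of "{s}"])
        fix r assume "r \<notin> {s}"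
        then show "q s r = pr (f' s) (indicator {0..s} r *\<^sub>R g' r)"
          using True by (auto simp: q_def a_def b_def indicator_def zero_right)
      qed auto
      also have "\<dots> = pr (f' s) (LINT r:{0..s}|lborel. g' r)"
        unfolding set_lebesgue_integral_def
        by (rule integral_bounded_linear[OF bounded_linear_right int])
      finally show ?thesis using True t primitive_onD[OF g, of s] by simp
    next
      case False
      then show ?thesis by (auto simp: q_def a_def zero_left)
    qed
    have int1: "integrable lborel (\<lambda>r. indicator {0..t} r *\<^sub>R pr (f r - f 0) (g' r))"
      using lborel_pair.integrable_snd[OF p] by (simp add: pint)
    have int2: "integrable lborel (\<lambda>s. indicator {0..t} s *\<^sub>R pr (f' s) (g s - g 0))"
      using lborel_pair.integrable_fst[OF q] by (simp add: qint)
    have int3: "integrable lborel (\<lambda>s. pr (a s) (g 0))" "integrable lborel (\<lambda>s. pr (f 0) (b s))"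
      using integrable_bounded_linear[OF bounded_linear_left a]
        integrable_bounded_linear[OF bounded_linear_right b] by auto
    have i3: "(LINT s|lborel. pr (a s) (g 0)) = pr (f t - f 0) (g 0)"
      using integral_bounded_linear[OF bounded_linear_left a] primitive_onD[OF f t]
      by (simp add: a_def[abs_def] set_lebesgue_integral_def)
    have i4: "(LINT s|lborel. pr (f 0) (b s)) = pr (f 0) (g t - g 0)"
      using integral_bounded_linear[OF bounded_linear_right b] primitive_onD[OF g t]
      by (simp add: b_def[abs_def] set_lebesgue_integral_def)
    have "pr (f t - f 0) (g t - g 0) = pr (LINT s|lborel. a s) (LINT r|lborel. b r)"
      using primitive_onD[OF g t] primitive_onD[OF f t]
      by (simp add: b_def[abs_def] a_def[abs_def] set_lebesgue_integral_def)
    also have "\<dots> = (LINT s|lborel. pr (a s) (LINT r|lborel. b r))"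
      by (rule integral_bounded_linear[OF bounded_linear_left a, symmetric])
    also have "\<dots> = (LINT s|lborel. (LINT r|lborel. pr (a s) (b r)))"
      by (intro Bochner_Integration.integral_cong refl
          integral_bounded_linear[OF bounded_linear_right b, symmetric])
    also have "\<dots> = integral\<^sup>L (lborel \<Otimes>\<^sub>M lborel) (\<lambda>(s, r). pr (a s) (b r))"
      using h by (intro lborel_pair.integral_fst) (simp add: case_prod_beta')
    also have "\<dots> = integral\<^sup>L (lborel \<Otimes>\<^sub>M lborel) (\<lambda>x. case_prod p x + case_prod q x)"
      by (intro Bochner_Integration.integral_cong) (auto simp: p_def q_def indicator_def)
    also have "\<dots> = (LINT r|lborel. (LINT s|lborel. p s r)) + (LINT s|lborel. (LINT r|lborel. q s r))"
      using p q by (simp add: lborel_pair.integral_fst lborel_pair.integral_snd)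
    finally have main: "pr (f t - f 0) (g t - g 0) =
      (LINT r|lborel. indicator {0..t} r *\<^sub>R pr (f r - f 0) (g' r)) +
      (LINT s|lborel. indicator {0..t} s *\<^sub>R pr (f' s) (g s - g 0))"
      by (simp add: pint qint)
    \<comment> \<open>\<open>main\<close> is the product rule for the increments
      \<open>f - f 0\<close> and \<open>g - g 0\<close>; this restores the terms that involve the
      initial values.\<close>
    have eq: "indicator {0..t} s *\<^sub>R (pr (f' s) (g s) + pr (f s) (g' s)) =
      (indicator {0..t} s *\<^sub>R pr (f s - f 0) (g' s) + indicator {0..t} s *\<^sub>R pr (f' s) (g s - g 0))
      + (pr (a s) (g 0) + pr (f 0) (b s))" for s
      by (auto simp: a_def b_def indicator_def diff_left diff_right zero_left zero_right)
    have "(LINT s:{0..t}|lborel. pr (f' s) (g s) + pr (f s) (g' s)) =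
      pr (f t - f 0) (g t - g 0) + (pr (f t - f 0) (g 0) + pr (f 0) (g t - g 0))"
      unfolding set_lebesgue_integral_def eq main i3[symmetric] i4[symmetric]
      using int1 int2 int3 by (simp del: integral_indicator)
    then show ?thesis
      unfolding eq using int1 int2 int3 by (auto simp: diff_left diff_right)
  qed
  show ?thesis
    unfolding primitive_on_def
  proof (intro conjI ballI)
    show "set_integrable lborel {0..T} (\<lambda>t. pr (f' t) (g t) + pr (f t) (g' t))"
      using key[of T] by (cases "0 \<le> T") (simp_all add: set_integrable_def)
  qed (rule conjunct2[OF key], auto)
qed

section \<open>Vanishing criteria and Gronwall uniqueness\<close>

text \<open>Extended by zero, \<open>h\<close> has integral zero over every half-line
  \<open>{..t}\<close>. Half-lines form an intersection-stable generator of the Borel sets, so by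
  Dynkin's argument the integral is zero over every Borel set, which forces \<open>h = 0\<close>
  almost everywhere.\<close>

lemma AE_eq_0_if_primitive_0:
  assumes "primitive_on T (\<lambda>_. 0) h"
  shows "AE t in lborel. t \<in> {0..T} \<longrightarrow> h t = 0"
proof -
  define g where "g = (\<lambda>t. indicator {0..T} t *\<^sub>R h t)"
  have g: "integrable lborel g"
    using assms by (simp add: primitive_on_def set_integrable_def g_def)
  have gi: "set_integrable lborel A g" if "A \<in> sets borel" for A
    using integrable_mult_indicator[OF _ g, of A] that by (simp add: set_integrable_def)
  have low: "(LINT s:{..t}|lborel. g s) = 0" for t
  proof (cases "0 \<le> min t T")
    case True
    have "(LINT s:{..t}|lborel. g s) = (LINT s:{0..min t T}|lborel. h s)"
      unfolding set_lebesgue_integral_def g_def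
      by (intro Bochner_Integration.integral_cong) (auto simp: indicator_def)
    also have "\<dots> = 0"
      using primitive_onD[OF assms, of "min t T"] True by simp
    finally show ?thesis .
  next
    case False
    then have "indicator {..t} s *\<^sub>R g s = 0" for s
      by (auto simp: g_def indicator_def)
    then show ?thesis unfolding set_lebesgue_integral_def by (simp only: integral_zero)
  qed
  have UN: "(LINT s|lborel. g s) = 0"
  proof -
    have "(LINT s|lborel. g s) = (LINT s:{..T}|lborel. g s)"
      unfolding set_lebesgue_integral_def
      by (intro Bochner_Integration.integral_cong) (auto simp: g_def indicator_def)
    then show ?thesis using low by simp
  qed
  have "set_lebesgue_integral lborel A g = 0" if "A \<in> sets borel" for A
  proof -
    let ?G = "range (\<lambda>a::real. {..a})"
    have sets: "sigma_sets UNIV ?G = sets (borel :: real measure)"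
      unfolding borel_eq_atMost by simp
    have "Int_stable ?G" by (auto simp: Int_stable_def Int_atMost)
    moreover have "?G \<subseteq> Pow UNIV" by simp
    moreover have "A \<in> sigma_sets UNIV ?G" using that by (simp only: sets)
    ultimately show ?thesis
    proof (induction A rule: sigma_sets_induct_disjoint)
      case (basic A)
      then show ?case using low by auto
    next
      case empty
      show ?case by (simp add: set_lebesgue_integral_def)
    next
      case (compl A)
      then have A: "A \<in> sets borel" by (simp only: sets)
      have "(LINT s:A \<union> (UNIV - A)|lborel. g s)
          = (LINT s:A|lborel. g s) + (LINT s:UNIV - A|lborel. g s)"
        using A by (intro set_integral_Un gi) auto
      then show ?case using UN compl.IH by (simp add: set_lebesgue_integral_def)
    next
      case (union A)
      then have A: "A i \<in> sets borel" for i unfolding sets by auto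
      have "(LINT s:(\<Union>i. A i)|lborel. g s) = (\<Sum>i. LINT s:A i|lborel. g s)"
        using A union.hyps by (intro lebesgue_integral_countable_add gi)
          (auto simp: disjoint_family_on_def)
      then show ?case using union.IH by simp
    qed
  qed
  then have "AE s in lborel. g s = 0"
    using sigma_finite_measure.density_zero[OF sigma_finite_lborel g] by simp
  then show ?thesis
    by eventually_elim (auto simp: g_def)
qed

text \<open>The points of the open interval where \<open>h\<close> is nonzero form an open null set,
  which must be empty. Continuity then covers the two endpoints.\<close>

lemma eq_0_if_AE_eq_0:
  fixes h :: "real \<Rightarrow> 'a::real_normed_vector"
  assumes "T > 0" and cont: "continuous_on {0..T} h"
    and AE: "AE t in lborel. t \<in> {0..T} \<longrightarrow> h t = 0" and t: "t \<in> {0..T}"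
  shows "h t = 0"
proof -
  have "open ({0<..<T} \<inter> h -` (- {0}))"
    by (rule continuous_open_preimage) (auto intro: continuous_on_subset[OF cont])
  moreover have "{0<..<T} \<inter> h -` (- {0}) = {t \<in> {0<..<T}. h t \<in> - {0}}"
    by blast
  ultimately have "open {t \<in> {0<..<T}. h t \<in> - {0}}"
    by simp
  moreover have "negligible {t \<in> {0<..<T}. h t \<in> - {0}}"
  proof -
    from AE obtain N where N: "N \<in> null_sets lborel"
      "\<And>t. t \<in> space lborel - N \<Longrightarrow> t \<in> {0..T} \<longrightarrow> h t = 0"
      by (rule AE_E3) blast
    then have "negligible N"
      by (simp add: negligible_iff_null_sets null_sets_completionI)
    then show ?thesis by (rule negligible_subset) (use N(2) in fastforce)
  qed
  ultimately have "{t \<in> {0<..<T}. h t \<in> - {0}} = {}"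
    using open_not_negligible by blast
  then have "h s = 0" if "s \<in> {0<..<T}" for s using that by auto
  moreover have "closure {0<..<T} = {0..T}" using \<open>T > 0\<close> by simp
  ultimately show ?thesis
    using continuous_constant_on_closure[of "{0<..<T}" h 0 t] cont t by simp
qed

text \<open>Passage to the Henstock-Kurzweil integral, in which continuity of the indefinite
  integral and splitting of intervals are used below.\<close>

lemma primitive_on_eq_integral:
  fixes f :: "real \<Rightarrow> 'a::euclidean_space"
  assumes "primitive_on T f h" "t \<in> {0..T}"
  shows "h integrable_on {0..t}" "f t = f 0 + integral {0..t} h"
proof -
  have "set_integrable lborel {0..t} h"
    using assms unfolding primitive_on_def by (auto intro: set_integrable_subset)
  from set_borel_integral_eq_integral[OF this]
  show "h integrable_on {0..t}" "f t = f 0 + integral {0..t} h"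
    using primitive_onD[OF assms(1), of t] assms(2) by auto
qed

lemma primitive_on_continuous:
  fixes f :: "real \<Rightarrow> 'a::euclidean_space"
  assumes "primitive_on T f h"
  shows "continuous_on {0..T} f"
proof (cases "0 \<le> T")
  case True
  then have "continuous_on {0..T} (\<lambda>t. f 0 + integral {0..t} h)"
    using primitive_on_eq_integral(1)[OF assms, of T]
    by (intro continuous_intros indefinite_integral_continuous_1) auto
  then show ?thesis
    by (rule continuous_on_eq) (rule primitive_on_eq_integral(2)[OF assms, symmetric])
qed auto

text \<open>The interval is cut into pieces on which \<open>a\<close> has integral below 1/2. If
  \<open>f\<close> vanishes up to the start of a piece, the maximum of \<open>norm (f s)\<close> on
  it is at most half of itself, so \<open>f\<close> vanishes there too.\<close>

lemma primitive_on_gronwall: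
  fixes f :: "real \<Rightarrow> 'a::euclidean_space"
  assumes f: "primitive_on T f h" and a: "set_integrable lborel {0..T} a"
    and nn: "\<And>t. t \<in> {0..T} \<Longrightarrow> 0 \<le> a t"
    and le: "\<And>t. t \<in> {0..T} \<Longrightarrow> norm (h t) \<le> a t * norm (f t)"
    and f0: "f 0 = 0" and t: "t \<in> {0..T}"
  shows "f t = 0"
proof -
  have ai: "a integrable_on {0..T}" using set_borel_integral_eq_integral(1)[OF a] .
  have "uniformly_continuous_on {0..T} (\<lambda>x. integral {0..x} a)"
    by (intro compact_uniformly_continuous indefinite_integral_continuous_1 ai) simp
  \<comment> \<open>Uniform continuity gives one \<open>d\<close> for all pieces; pieces of length
    at most \<open>d/2\<close> stay strictly within it.\<close>
  from uniformly_continuous_onE[OF this, of "1/2"] obtain d where d: "d > 0"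
    "\<And>x y. x \<in> {0..T} \<Longrightarrow> y \<in> {0..T} \<Longrightarrow> dist y x < d \<Longrightarrow>
        dist (integral {0..y} a) (integral {0..x} a) < 1/2"
    by auto
  have step: "\<forall>t\<in>{0..T} \<inter> {..real k * (d/2)}. f t = 0" for k
  proof (induction k)
    case 0
    have "t = 0" if "t \<in> {0..T} \<inter> {..real 0 * (d/2)}" for t using that by simp
    then show ?case using f0 by blast
  next
    case (Suc k)
    define x where "x = real k * (d/2)"
    define y where "y = min T (x + d/2)"
    have x0: "0 \<le> x" using d by (simp add: x_def)
    show ?case
    proof (cases "x \<le> T")
      case False
      then show ?thesis using Suc by (auto simp: x_def)
    next
      case True
      then have xy: "x \<le> y" "y \<le> T" using d by (auto simp: y_def)
      have z: "f s = 0" if "0 \<le> s" "s \<le> x" for s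
        using Suc that True by (auto simp: x_def)
      have "continuous_on {x..y} (\<lambda>s. norm (f s))"
        using x0 xy
        by (intro continuous_on_norm continuous_on_subset[OF primitive_on_continuous[OF f]]) auto
      then obtain m where m: "m \<in> {x..y}" "\<And>s. s \<in> {x..y} \<Longrightarrow> norm (f s) \<le> norm (f m)"
        using continuous_attains_sup[of "{x..y}" "\<lambda>s. norm (f s)"] xy by auto
      have mT: "0 \<le> x" "x \<le> m" "m \<le> T" using m x0 xy by auto
      have int: "h integrable_on {0..m}" "a integrable_on {0..m}" "h integrable_on {x..m}"
        "a integrable_on {x..m}"
        using primitive_on_eq_integral(1)[OF f, of m] ai mT
        by (auto intro: integrable_on_subinterval)
      have "f m = f x + integral {x..m} h"
        using primitive_on_eq_integral(2)[OF f, of x] primitive_on_eq_integral(2)[OF f, of m] mT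
          Henstock_Kurzweil_Integration.integral_combine[OF mT(1,2) int(1)] by simp
      then have "norm (f m) = norm (integral {x..m} h)"
        using z[of x] x0 by simp
      also have "\<dots> \<le> integral {x..m} (\<lambda>s. a s * norm (f m))"
      proof (rule integral_norm_bound_integral)
        fix s assume s: "s \<in> {x..m}"
        then have "norm (h s) \<le> a s * norm (f s)" using mT by (intro le) auto
        also have "\<dots> \<le> a s * norm (f m)"
          using s mT m by (intro mult_left_mono nn m) auto
        finally show "norm (h s) \<le> a s * norm (f m)" .
      qed (use int in \<open>auto intro: integrable_on_mult_left\<close>)
      also have "\<dots> = (integral {0..m} a - integral {0..x} a) * norm (f m)"
        using Henstock_Kurzweil_Integration.integral_combine[OF mT(1,2) int(2), symmetric]
        by (simp add: algebra_simps)
      also have "\<dots> \<le> 1/2 * norm (f m)"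
      proof (rule mult_right_mono)
        have "dist m x < d" using m d by (auto simp: y_def dist_real_def)
        then have "\<bar>integral {0..m} a - integral {0..x} a\<bar> < 1/2"
          using d(2)[of x m] mT by (simp add: dist_real_def)
        then show "integral {0..m} a - integral {0..x} a \<le> 1/2" by linarith
      qed simp
      finally have "f m = 0" by simp
      then have "f s = 0" if "s \<in> {x..y}" for s using m(2)[OF that] by simp
      moreover have "s \<in> {x..y} \<or> s \<le> x" if "s \<le> T" "s \<le> real (Suc k) * (d/2)" for s
        using that by (auto simp: y_def x_def algebra_simps)
      ultimately have "f s = 0" if "0 \<le> s" "s \<le> T" "s \<le> real (Suc k) * (d/2)" for s
        using that z[of s] by blast
      then show ?thesis by simp
    qed
  qed
  obtain k where "T / (d/2) \<le> real k" using real_arch_simple by blast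
  then have "t \<le> real k * (d/2)" using t d by (auto simp: field_simps)
  then show ?thesis using step[of k] t by auto
qed

section \<open>Conjugation along trajectories\<close>

lemmas mat_entries = vec_eq_iff forall_2 matrix_matrix_mult_def sum_2 mat2_def
  adj_def trace_def mat_def

text \<open>The adjoint for the indefinite form \<open>Jm\<close>: it is the inverse on \<open>SU11\<close> and
  the negation on \<open>su11\<close>.\<close>

definition sig :: "cmat \<Rightarrow> cmat" where
  "sig M = Jm ** adj M ** Jm"

definition com :: "cmat \<Rightarrow> cmat \<Rightarrow> cmat" where
  "com M N = M ** N - N ** M"

lemma sig_mult: "sig (M ** N) = sig N ** sig M"
  by (simp add: sig_def Jm_def mat_entries algebra_simps)

lemma sig_sig: "sig (sig M) = M"
  by (simp add: sig_def Jm_def mat_entries)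

lemma trace_sig: "trace (sig M) = cnj (trace M)"
  by (simp add: sig_def Jm_def mat_entries)

lemma sig_mat_1: "sig (mat 1) = mat 1"
  by (simp add: sig_def Jm_def mat_entries)

lemma linear_sig: "linear sig"
  by (rule linearI) (simp_all add: sig_def Jm_def mat_entries)

lemma su11_entries:
  assumes "M \<in> su11"
  shows "M $ 2 $ 2 = - M $ 1 $ 1" "cnj (M $ 1 $ 1) = - M $ 1 $ 1" "M $ 2 $ 1 = cnj (M $ 1 $ 2)"
proof -
  obtain a b c :: real where M: "M = a *\<^sub>R Kx + b *\<^sub>R Ky + c *\<^sub>R Kz"
    using assms by (auto simp: su11_def)
  show "M $ 2 $ 2 = - M $ 1 $ 1" "cnj (M $ 1 $ 1) = - M $ 1 $ 1" "M $ 2 $ 1 = cnj (M $ 1 $ 2)"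
    unfolding M by (simp_all add: Kx_def Ky_def Kz_def mat2_def complex_eq_iff)
qed

lemma sig_su11: "M \<in> su11 \<Longrightarrow> sig M = - M"
  using su11_entries[of M] by (simp add: sig_def Jm_def mat_entries)

text \<open>\<open>sig\<close> commutes with \<open>adj\<close>, because \<open>Jm\<close> is
  hermitian. This makes the pairing with a multiplier from \<open>su11\<close> real-valued later
  on.\<close>

lemma sig_adj_su11: "M \<in> su11 \<Longrightarrow> sig (adj M) = - adj M"
  using su11_entries[of M] by (simp add: sig_def Jm_def mat_entries)

lemma trace_su11: "M \<in> su11 \<Longrightarrow> trace M = 0"
  using su11_entries[of M] by (simp add: mat_entries)

lemma adj_adj: "adj (adj M) = M"
  by (simp add: adj_def vec_eq_iff)

lemma trace_adj: "trace (adj M) = cnj (trace M)"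
  by (simp add: mat_entries)

lemma adj_mult: "adj (M ** N) = adj N ** adj M"
  by (simp add: mat_entries algebra_simps)

lemma bounded_bilinear_cmat_mult: "bounded_bilinear ((**) :: cmat \<Rightarrow> cmat \<Rightarrow> cmat)"
proof -
  have "bilinear ((**) :: cmat \<Rightarrow> cmat \<Rightarrow> cmat)"
    unfolding bilinear_def
    by (intro conjI allI linearI) (simp_all add: mat_entries algebra_simps)
  then show ?thesis by (simp add: bilinear_conv_bounded_bilinear)
qed

lemmas cmat_mult_minus =
  bounded_bilinear.minus_left[OF bounded_bilinear_cmat_mult]
  bounded_bilinear.minus_right[OF bounded_bilinear_cmat_mult]

lemma bounded_linear_trace_mult: "bounded_linear (\<lambda>W::cmat. trace (P ** W))"
  by (intro linear_linear[THEN iffD2] linearI | simp add: linear_conv_bounded_linear[symmetric])+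
     (simp_all add: mat_entries algebra_simps)

lemma trajectory_primitive_on:
  assumes X: "trajectory A B u T X" and T: "T \<ge> 0"
  shows "X 0 = mat 1 \<and> primitive_on T X (\<lambda>s. (A + u s *\<^sub>R B) ** X s)"
proof -
  have eq: "X t = mat 1 + (LINT s:{0..t}|lborel. (A + u s *\<^sub>R B) ** X s)" if "t \<in> {0..T}" for t
    using X that unfolding trajectory_def by blast
  have int: "set_integrable lborel {0..T} (\<lambda>s. (A + u s *\<^sub>R B) ** X s)"
    using X unfolding trajectory_def by blast
  have "set_integrable lborel {0..0} (\<lambda>s. (A + u s *\<^sub>R B) ** X s)"
    using T by (intro set_integrable_subset[OF int]) auto
  from set_borel_integral_eq_integral(2)[OF this]
  have "(LINT s:{0..0}|lborel. (A + u s *\<^sub>R B) ** X s) = 0" by simp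
  then have X0: "X 0 = mat 1" using eq[of 0] T by simp
  then show ?thesis
    unfolding primitive_on_def using int eq by (metis (no_types))
qed

text \<open>Product rule with \<open>Z = A + u t *\<^sub>R B\<close>: \<open>sig\<close> is
  real-linear and \<open>sig Z = - Z\<close>, so the derivative of \<open>sig (X t)\<close> is
  \<open>- sig (X t) ** Z\<close>, and the two terms combine to a commutator.\<close>

lemma primitive_on_conj:
  assumes "A \<in> su11" "B \<in> su11" "trajectory A B u T X" "T \<ge> 0"
  shows "primitive_on T (\<lambda>t. sig (X t) ** N ** X t)
           (\<lambda>t. sig (X t) ** com N (A + u t *\<^sub>R B) ** X t)"
proof -
  note X = conjunct2[OF trajectory_primitive_on[OF assms(3,4)]]
  have bl: "bounded_linear (\<lambda>M. sig M ** N)"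
    using bounded_linear_compose[OF bounded_bilinear.bounded_linear_left[OF bounded_bilinear_cmat_mult, of N]]
      linear_sig linear_conv_bounded_linear by blast
  have *: "sig (A + c *\<^sub>R B) = - (A + c *\<^sub>R B)" for c
    using sig_su11[OF assms(1)] sig_su11[OF assms(2)] linear_add[OF linear_sig] linear_scale[OF linear_sig]
    by simp
  have "sig ((A + u t *\<^sub>R B) ** X t) ** N ** X t + sig (X t) ** N ** ((A + u t *\<^sub>R B) ** X t) =
      sig (X t) ** com N (A + u t *\<^sub>R B) ** X t" for t
    unfolding sig_mult * com_def
    by (simp add: mat_entries algebra_simps)
  then show ?thesis
    using primitive_on_bilinear[OF bounded_bilinear_cmat_mult primitive_on_bounded_linear[OF bl X] X]
    by simp
qed

lemma primitive_on_const:
  assumes f: "primitive_on T f h" and h: "\<And>t. t \<in> {0..T} \<Longrightarrow> h t = 0" and t: "t \<in> {0..T}"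
  shows "f t = f 0"
proof -
  have "primitive_on T f (\<lambda>_. 0)"
    by (rule primitive_on_cong[OF f]) (use h in auto)
  from primitive_onD[OF this, of t] t show ?thesis by simp
qed

text \<open>Conjugating \<open>mat 1\<close> has derivative zero, so \<open>sig (X t) ** X t\<close>
  keeps its initial value \<open>mat 1\<close>.\<close>

lemma trajectory_inverse:
  assumes "A \<in> su11" "B \<in> su11" "trajectory A B u T X" "t \<in> {0..T}"
  shows "sig (X t) ** X t = mat 1" "X t ** sig (X t) = mat 1" "matrix_inv (X t) = sig (X t)"
proof -
  have T: "T \<ge> 0" using assms(4) by simp
  have "sig (X t) ** mat 1 ** X t = sig (X 0) ** mat 1 ** X 0"
    by (rule primitive_on_const[OF primitive_on_conj[OF assms(1-3) T] _ assms(4)])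
      (simp add: com_def matrix_mul_lid matrix_mul_rid)
  then show 1: "sig (X t) ** X t = mat 1"
    using trajectory_primitive_on[OF assms(3) T] by (simp add: sig_mat_1)
  then show 2: "X t ** sig (X t) = mat 1"
    by (simp add: matrix_left_right_inverse)
  have "matrix_inv (X t) ** X t = mat 1"
    unfolding matrix_inv_def
    by (rule someI2[where a = "sig (X t)"]) (use 1 2 in blast)+
  then show "matrix_inv (X t) = sig (X t)"
    using 2 by (metis matrix_mul_assoc matrix_mul_lid matrix_mul_rid)
qed

section \<open>Trace identities for traceless 2-by-2 matrices\<close>

text \<open>The triple product identity of sl(2), paired with \<open>M\<close>: the bracket acts
  like a cross product and the trace form like a scalar product.\<close>

lemma com_com:
  assumes "trace A = 0" "trace B = 0" "trace Z = 0"
  shows "trace (M ** com (com A B) Z)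
    = 2 * trace (B ** Z) * trace (M ** A) - 2 * trace (A ** Z) * trace (M ** B)"
proof -
  have "A $ 2 $ 2 = - A $ 1 $ 1" "B $ 2 $ 2 = - B $ 1 $ 1" "Z $ 2 $ 2 = - Z $ 1 $ 1"
    using assms by (simp_all add: mat_entries eq_neg_iff_add_eq_0 add.commute)
  then show ?thesis by (simp add: com_def mat_entries algebra_simps power2_eq_square)
qed

text \<open>Up to the factor \<open>trace (C ** C)\<close>, the brackets \<open>[B,C]\<close>, \<open>[C,A]\<close>, \<open>C\<close> are the basis
  dual to \<open>A\<close>, \<open>B\<close>, \<open>C\<close> for the trace form.\<close>

lemma dual_basis_expansion:
  assumes "trace A = 0" "trace B = 0" "trace M = 0"
  defines "C \<equiv> com A B"
  shows "trace (C ** C) * M $ i $ j =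
    trace (M ** A) * com B C $ i $ j + trace (M ** B) * com C A $ i $ j + trace (M ** C) * C $ i $ j"
proof -
  have "A $ 2 $ 2 = - A $ 1 $ 1" "B $ 2 $ 2 = - B $ 1 $ 1" "M $ 2 $ 2 = - M $ 1 $ 1"
    using assms(1-3) by (simp_all add: mat_entries eq_neg_iff_add_eq_0 add.commute)
  then have "\<forall>i j. trace (C ** C) * M $ i $ j =
    trace (M ** A) * com B C $ i $ j + trace (M ** B) * com C A $ i $ j + trace (M ** C) * C $ i $ j"
    unfolding C_def com_def forall_2
    by (intro conjI; simp add: mat_entries algebra_simps)
  then show ?thesis by blast
qed

text \<open>Lagrange's identity: the right side is -2 times the Gram determinant of
  \<open>A\<close>, \<open>B\<close> for the trace form.\<close>

lemma trace_com_com: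
  assumes "trace A = 0" "trace B = 0"
  shows "trace (com A B ** com A B) = 2 * (trace (A ** B))\<^sup>2 - 2 * trace (A ** A) * trace (B ** B)"
proof -
  have "A $ 2 $ 2 = - A $ 1 $ 1" "B $ 2 $ 2 = - B $ 1 $ 1"
    using assms by (simp_all add: mat_entries eq_neg_iff_add_eq_0 add.commute)
  then show ?thesis by (simp add: com_def mat_entries algebra_simps power2_eq_square)
qed

section \<open>Abnormal extremals\<close>

lemma mat2_in_SU11:
  assumes "a * cnj a - b * cnj b = 1"
  shows "mat2 a b (cnj b) (cnj a) \<in> SU11"
  using assms by (simp add: SU11_def Jm_def det_2 mat_entries algebra_simps)

lemma sig_mat2: "sig (mat2 a b c d) = mat2 (cnj a) (- cnj c) (- cnj b) (cnj d)"
  by (simp add: sig_def Jm_def mat_entries)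

text \<open>\<open>inv\<close> expresses by vanishing 2-by-2 minors that every group element keeps
  the line of \<open>n\<close>. The adjoint representation on traceless complex matrices is
  irreducible, and one rotation with one boost suffices to show that no such line exists.\<close>

lemma no_invariant_line:
  assumes "trace n = 0"
    and inv: "\<And>X i j k l. X \<in> SU11 \<Longrightarrow>
      (sig X ** n ** X) $ i $ j * n $ k $ l = (sig X ** n ** X) $ k $ l * n $ i $ j"
  shows "n = 0"
proof -
  have d: "n $ 2 $ 2 = - n $ 1 $ 1"
    using assms(1) by (simp add: mat_entries eq_neg_iff_add_eq_0 add.commute)
  \<comment> \<open>A rotation leaves only the weight lines of the diagonal torus, and a boost moves those.\<close>
  obtain w where w: "w * cnj w = 1" "w \<noteq> 0" "w \<noteq> cnj w" "cnj w * cnj w \<noteq> w * w"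
    by (rule that[of "Complex (3/5) (4/5)"]) (simp_all add: complex_eq_iff)
  define R where "R = mat2 w 0 (cnj 0) (cnj w)"
  \<comment> \<open>A boost with rational entries: 25/16 - 9/16 = 1.\<close>
  define H where "H = mat2 (5/4) (3/4) (cnj (3/4)) (cnj (5/4))"
  have R: "R \<in> SU11" unfolding R_def by (rule mat2_in_SU11) (simp add: w)
  have H: "H \<in> SU11" unfolding H_def by (rule mat2_in_SU11) (simp add: complex_eq_iff)
  \<comment> \<open>Conjugation by \<open>R\<close> multiplies the entries 11, 12, 21 by 1,
    \<open>cnj w * cnj w\<close>, \<open>w * w\<close>. These are distinct, so at most one of the
    entries is nonzero.\<close>
  have 1: "n $ 1 $ 1 * n $ 1 $ 2 = 0" "n $ 1 $ 1 * n $ 2 $ 1 = 0" "n $ 1 $ 2 * n $ 2 $ 1 = 0"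
    using inv[OF R, of 1 1 1 2] inv[OF R, of 1 1 2 1] inv[OF R, of 1 2 2 1] w
    unfolding R_def sig_mat2 by (auto simp: mat2_def matrix_matrix_mult_def sum_2)
  let ?V = "sig H ** n ** H"
  let ?a = "n $ 1 $ 1" and ?b = "n $ 1 $ 2" and ?c = "n $ 2 $ 1"
  have V: "16 * ?V $ 1 $ 1 = 34 * ?a + 15 * ?b - 15 * ?c"
    "16 * ?V $ 1 $ 2 = 30 * ?a + 25 * ?b - 9 * ?c"
    "16 * ?V $ 2 $ 1 = 25 * ?c - 30 * ?a - 9 * ?b"
    unfolding H_def sig_mat2 by (simp_all add: mat2_def matrix_matrix_mult_def sum_2 d algebra_simps)
  have "16 * ?V $ 1 $ 1 * ?b = 16 * ?V $ 1 $ 2 * ?a" "16 * ?V $ 1 $ 1 * ?c = 16 * ?V $ 2 $ 1 * ?a"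
    using inv[OF H, of 1 1 1 2] inv[OF H, of 1 1 2 1] by simp_all
  then have "15 * ?b * ?b = 30 * ?a * ?a" "15 * ?c * ?c = 30 * ?a * ?a"
    unfolding V using 1 by algebra+
  then have "?a = 0 \<and> ?b = 0 \<and> ?c = 0"
    using 1 by auto
  then show ?thesis using d by (simp add: mat_entries)
qed

lemma cmat_mult_multiple:
  fixes M N Y Z :: cmat
  assumes "\<And>i j. M $ i $ j = c * N $ i $ j"
  shows "(Y ** M ** Z) $ i $ j = c * (Y ** N ** Z) $ i $ j"
  by (simp add: matrix_matrix_mult_def assms sum_distrib_left sum_distrib_right mult_ac)

text \<open>Each minor of the conjugated \<open>n\<close> against \<open>n\<close> solves a scalar
  linear equation with initial value zero, so it stays zero. Every reachable matrix thus preserves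
  the line of \<open>n\<close>, which the whole group cannot do.\<close>

lemma not_controllable_if_eigenvector:
  assumes A: "A \<in> su11" and B: "B \<in> su11" and n: "trace n = 0" "n \<noteq> 0"
    and ev: "\<And>i j. com A n $ i $ j = \<alpha> * n $ i $ j" "\<And>i j. com B n $ i $ j = \<beta> * n $ i $ j"
  shows "\<not> controllable A B"
proof
  assume ctrl: "controllable A B"
  have "(sig Z ** n ** Z) $ i $ j * n $ k $ l = (sig Z ** n ** Z) $ k $ l * n $ i $ j"
    if "Z \<in> SU11" for Z i j k l
  proof -
    from bspec[OF ctrl[unfolded controllable_def] that]
    obtain u T X where T: "T \<ge> 0" and u: "admissible u T" and X: "trajectory A B u T X" "X T = Z"
      by (elim exE conjE)
    define L where "L = (\<lambda>W::cmat. W $ i $ j * n $ k $ l - W $ k $ l * n $ i $ j)"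
    have L: "bounded_linear L"
      unfolding L_def linear_conv_bounded_linear[symmetric]
      by (rule linearI) (simp_all add: algebra_simps)
    let ?W = "\<lambda>t. sig (X t) ** n ** X t"
    let ?W' = "\<lambda>t. sig (X t) ** com n (A + u t *\<^sub>R B) ** X t"
    have W: "primitive_on T (\<lambda>t. L (?W t)) (\<lambda>t. L (?W' t))"
      by (rule primitive_on_bounded_linear[OF L primitive_on_conj[OF A B X(1) T]])
    have "com n (A + c *\<^sub>R B) $ p $ q = - (\<alpha> + c *\<^sub>R \<beta>) * n $ p $ q" for c p q
    proof -
      have "com n (A + c *\<^sub>R B) $ p $ q = - (com A n $ p $ q) - c *\<^sub>R (com B n $ p $ q)"
        by (simp add: com_def matrix_matrix_mult_def sum_2 algebra_simps)
      then show ?thesis by (simp add: ev algebra_simps)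
    qed
    then have W': "L (?W' t) = - (\<alpha> + u t *\<^sub>R \<beta>) * L (?W t)" for t
    proof -
      have "?W' t $ p $ q = - (\<alpha> + u t *\<^sub>R \<beta>) * ?W t $ p $ q" for p q
        by (rule cmat_mult_multiple) fact
      then show ?thesis by (simp only: L_def) (simp add: right_diff_distrib)
    qed
    have "L (?W T) = 0"
    proof (rule primitive_on_gronwall[OF W])
      \<comment> \<open>This bounds the modulus of the coefficient in \<open>W'\<close>; it is
        integrable because \<open>u\<close> is.\<close>
      show "set_integrable lborel {0..T} (\<lambda>t. cmod \<alpha> + \<bar>u t\<bar> * cmod \<beta>)"
      proof (intro set_integral_add set_integrable_mult_left set_integrable_abs)
        show "set_integrable lborel {0..T} (\<lambda>t. cmod \<alpha>)"
          by (intro borel_integrable_atLeastAtMost' continuous_on_const)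
      qed (use u in \<open>simp add: admissible_def\<close>)
      fix t
      have "cmod (\<alpha> + u t *\<^sub>R \<beta>) \<le> cmod \<alpha> + \<bar>u t\<bar> * cmod \<beta>"
        by (rule norm_triangle_le) simp
      then show "norm (L (?W' t)) \<le> (cmod \<alpha> + \<bar>u t\<bar> * cmod \<beta>) * norm (L (?W t))"
        unfolding W' norm_mult norm_minus_cancel by (intro mult_right_mono) auto
    next
      show "L (?W 0) = 0"
        using trajectory_primitive_on[OF X(1) T] by (simp add: sig_mat_1 L_def)
    qed (use T in auto)
    then show ?thesis by (simp add: L_def X(2))
  qed
  then have "n = 0" by (rule no_invariant_line[OF n(1)])
  with n show False by simp
qed

text \<open>Commuting traceless 2-by-2 matrices have vanishing cross product, that is, proportional
  entries; a nonzero entry of \<open>n\<close> fixes the factor.\<close>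

lemma com_eq_0_imp_multiple:
  assumes "trace W = 0" "trace n = 0" "n \<noteq> 0" "com W n = 0"
  shows "\<exists>\<alpha>. \<forall>i j. W $ i $ j = \<alpha> * n $ i $ j"
proof -
  have d: "W $ 2 $ 2 = - W $ 1 $ 1" "n $ 2 $ 2 = - n $ 1 $ 1"
    using assms(1,2) by (simp_all add: mat_entries eq_neg_iff_add_eq_0 add.commute)
  have "com W n $ i $ j = 0" for i j using assms(4) by simp
  from this[of 1 1] this[of 1 2] this[of 2 1]
  have e: "W $ 1 $ 2 * n $ 2 $ 1 = n $ 1 $ 2 * W $ 2 $ 1"
    "W $ 1 $ 1 * n $ 1 $ 2 = n $ 1 $ 1 * W $ 1 $ 2"
    "W $ 2 $ 1 * n $ 1 $ 1 = n $ 2 $ 1 * W $ 1 $ 1"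
    unfolding com_def matrix_matrix_mult_def sum_2 vector_minus_component vec_lambda_beta d
    by algebra+
  obtain p q where pq: "n $ p $ q \<noteq> 0" using assms(3) by (auto simp: vec_eq_iff)
  have "\<forall>p q i j. W $ i $ j * n $ p $ q = W $ p $ q * n $ i $ j"
    unfolding forall_2 d by (intro conjI; ((simp; fail) | (insert e, algebra)))
  then have "\<forall>i j. W $ i $ j = W $ p $ q / n $ p $ q * n $ i $ j"
    using pq by (simp add: field_simps)
  then show ?thesis by blast
qed

lemma trace_com: "trace (com M N) = 0"
  by (simp add: com_def mat_entries algebra_simps)

text \<open>The trace form is nondegenerate: matrix units pick out the entries.\<close>

lemma eq_0_if_trace_mult_eq_0:
  fixes M :: cmat
  assumes "\<And>N::cmat. trace (N ** M) = 0"
  shows "M = 0"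
  using assms[of "mat2 1 0 0 0"] assms[of "mat2 0 1 0 0"] assms[of "mat2 0 0 1 0"]
    assms[of "mat2 0 0 0 1"]
  by (simp add: mat_entries)

text \<open>If \<open>C = [A,B]\<close> is null for the trace form, then \<open>C\<close> (or, if \<open>C = 0\<close>, one of \<open>A\<close>, \<open>B\<close>, \<open>Kx\<close>)
  spans a line invariant under \<open>ad A\<close> and \<open>ad B\<close>, which every trajectory must preserve.\<close>

lemma controllable_imp_trace_com_ne_0:
  assumes A: "A \<in> su11" and B: "B \<in> su11" and ctrl: "controllable A B"
  shows "trace (com A B ** com A B) \<noteq> 0"
proof
  note tr = trace_su11[OF A] trace_su11[OF B]
  define C where "C = com A B"
  assume "trace (com A B ** com A B) = 0"
  then have CC: "trace (C ** C) = 0" by (simp add: C_def)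
  have tC: "trace C = 0" by (simp add: C_def trace_com)
  have "\<exists>n \<alpha> \<beta>. trace n = 0 \<and> n \<noteq> 0 \<and>
    (\<forall>i j. com A n $ i $ j = \<alpha> * n $ i $ j) \<and> (\<forall>i j. com B n $ i $ j = \<beta> * n $ i $ j)"
  proof (cases "C = 0")
    case True
    then have z: "com A B = 0" "com B A = 0" by (simp_all add: C_def com_def)
    have "com M M = 0" "com 0 M = 0" for M
      by (simp_all add: com_def mat_entries)
    moreover have "Kx \<noteq> 0" "trace Kx = 0" by (simp_all add: Kx_def mat_entries)
    moreover consider "A \<noteq> 0" | "B \<noteq> 0" | "A = 0" "B = 0" by blast
    then have "\<exists>n. trace n = 0 \<and> n \<noteq> 0 \<and> com A n = 0 \<and> com B n = 0"
      using z tr calculation by cases metis+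
    then show ?thesis by (metis mult_zero_left zero_index)
  next
    case False
    \<comment> \<open>For \<open>M\<close> orthogonal to \<open>C\<close>, the triple product
      identity turns \<open>com (com M C) C\<close> into multiples of \<open>trace (C ** C)\<close>
      and \<open>trace (M ** C)\<close>, both zero. So \<open>com M C\<close> commutes with
      \<open>C\<close> and is a multiple of it.\<close>
    have "com (com A C) C = 0" "com (com B C) C = 0"
    proof -
      have z: "trace (A ** C) = 0" "trace (B ** C) = 0"
        by (simp_all add: C_def com_def mat_entries algebra_simps)
      have "com (com M C) C = 0" if "trace M = 0" "trace (M ** C) = 0" for M
      proof (rule eq_0_if_trace_mult_eq_0)
        show "trace (N ** com (com M C) C) = 0" for N
          using com_com[OF that(1) tC tC, of N] CC that(2) by simp
      qed
      then show "com (com A C) C = 0" "com (com B C) C = 0" using tr z by blast+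
    qed
    then show ?thesis
      using com_eq_0_imp_multiple[OF trace_com tC False]
        tC False by meson
  qed
  then show False using not_controllable_if_eigenvector[OF A B] ctrl by blast
qed

section \<open>Consequences of the maximum principle\<close>

text \<open>The condition is left undivided, so that it serves both for
  \<open>trace (B ** B)\<close> nonzero and for the null case.\<close>

lemma abnormal_extremal_condition:
  assumes A: "A \<in> su11" and B: "B \<in> su11" and CC: "trace (com A B ** com A B) \<noteq> 0"
    and abn: "abnormal_extremal A B u T X"
  shows "AE t in lborel. t \<in> {0..T} \<longrightarrow> trace (B ** A) + u t *\<^sub>R trace (B ** B) = 0"
proof -
  obtain S where T: "T > 0" and X: "trajectory A B u T X" and S: "S \<in> su11" "S \<noteq> 0"
    and min: "AE t in lborel. t \<in> {0..T} \<longrightarrow>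
           (\<forall>v::real. Re (ip S (matrix_inv (X t) ** (A + u t *\<^sub>R B) ** X t))
                      \<le> Re (ip S (matrix_inv (X t) ** (A + v *\<^sub>R B) ** X t)))"
    using abn unfolding abnormal_extremal_def by blast
  have T0: "T \<ge> 0" using T by simp
  define P where "P = adj S"
  have P0: "P \<noteq> 0" using S(2) adj_adj[of S] by (auto simp: P_def adj_def vec_eq_iff)
  have tP: "trace P = 0" using trace_su11[OF S(1)] by (simp add: P_def trace_adj)
  define F where "F N t = trace (P ** (sig (X t) ** N ** X t))" for N t
  have Fprim: "primitive_on T (F N) (\<lambda>t. F (com N (A + u t *\<^sub>R B)) t)" for N
    unfolding F_def[abs_def]
    by (rule primitive_on_bounded_linear[OF bounded_linear_trace_mult primitive_on_conj[OF A B X T0]])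
  \<comment> \<open>Minimality only controls real parts; reality of \<open>F\<close> on
    \<open>su11\<close> upgrades this to vanishing of \<open>F B\<close>.\<close>
  have F_real: "cnj (F N t) = F N t" if "N \<in> su11" for N t
  proof -
    let ?W = "sig (X t) ** N ** X t"
    have "sig ?W = - ?W"
      using sig_su11[OF that] by (simp add: sig_mult sig_sig matrix_mul_assoc cmat_mult_minus)
    then have "sig (P ** ?W) = ?W ** P"
      using sig_adj_su11[OF S(1)] by (simp add: sig_mult P_def cmat_mult_minus)
    then show ?thesis unfolding F_def
      by (metis trace_sig trace_mul_sym)
  qed
  have Re_ip: "Re (ip S (matrix_inv (X t) ** N ** X t)) = 2 * Re (F N t)" if "t \<in> {0..T}" for N t
  proof -
    have "trace (S ** adj W) = cnj (trace (P ** W))" for W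
      by (metis P_def adj_adj adj_mult trace_adj trace_mul_sym)
    then show ?thesis
      by (simp add: ip_def F_def trajectory_inverse(3)[OF A B X that])
  qed
  have F_lin: "F (A + c *\<^sub>R B) t = F A t + c *\<^sub>R F B t" for c t
    by (simp add: F_def mat_entries algebra_simps)
  have "AE t in lborel. t \<in> {0..T} \<longrightarrow> F B t = 0"
    using min
  proof eventually_elim
    case (elim t)
    show ?case
    proof
      assume t: "t \<in> {0..T}"
      define b where "b = Re (F B t)"
      \<comment> \<open>An affine function of \<open>v\<close> that is bounded below has slope zero;
        the test value \<open>v = u t - b\<close> exhibits this.\<close>
      have "u t * b \<le> (u t - b) * b"
        using elim t by (auto simp: Re_ip F_lin b_def dest!: spec[of _ "u t - Re (F B t)"])
      then have "b * b \<le> 0" by (simp add: algebra_simps)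
      then have "Re (F B t) = 0" by (auto simp: b_def mult_le_0_iff)
      then show "F B t = 0" using F_real[OF B, of t] by (simp add: complex_eq_iff)
    qed
  qed
  then have FB: "F B t = 0" if "t \<in> {0..T}" for t
    using eq_0_if_AE_eq_0[OF T primitive_on_continuous[OF Fprim]] that by blast
  \<comment> \<open>The control drops out of the first derivative of \<open>F B\<close>. Hence
    \<open>F (com B A)\<close> is again a primitive, so it is continuous, vanishes everywhere and
    can be differentiated once more.\<close>
  have com_B: "com B (A + c *\<^sub>R B) = com B A" for c
    by (simp add: com_def mat_entries algebra_simps)
  have "primitive_on T (\<lambda>_. 0) (F (com B A))"
    by (rule primitive_on_cong[OF Fprim[of B]]) (simp_all add: FB com_B)
  from eq_0_if_AE_eq_0[OF T primitive_on_continuous[OF Fprim] AE_eq_0_if_primitive_0[OF this]]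
  have FC: "F (com B A) t = 0" if "t \<in> {0..T}" for t using that by blast
  have "primitive_on T (\<lambda>_. 0) (\<lambda>t. F (com (com B A) (A + u t *\<^sub>R B)) t)"
    by (rule primitive_on_cong[OF Fprim[of "com B A"]]) (simp_all add: FC)
  from AE_eq_0_if_primitive_0[OF this] show ?thesis
  proof eventually_elim
    case (elim t)
    show ?case
    proof
      assume t: "t \<in> {0..T}"
      note inv = trajectory_inverse(1,2)[OF A B X t]
      define M where "M = X t ** P ** sig (X t)"
      have F: "F N t = trace (M ** N)" for N
        unfolding F_def M_def by (metis trace_mul_sym matrix_mul_assoc)
      have P_eq: "sig (X t) ** M ** X t = P"
        unfolding M_def by (metis inv matrix_mul_assoc matrix_mul_lid matrix_mul_rid)
      then have M0: "M \<noteq> 0" using P0 by (auto simp: mat_entries)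
      have "trace M = F (mat 1) t" by (simp add: F)
      then have tM: "trace M = 0" by (simp add: F_def inv tP)
      let ?Z = "A + u t *\<^sub>R B"
      have trB: "trace B = 0" and trA: "trace A = 0" using trace_su11 A B by auto
      have "trace ?Z = trace A + u t *\<^sub>R trace B" by (simp add: trace_def sum_2 algebra_simps)
      then have trZ: "trace ?Z = 0" using trA trB by simp
      have MB: "trace (M ** B) = 0" using FB[OF t] F by simp
      have "trace (M ** com A B) = - trace (M ** com B A)"
        by (simp add: com_def mat_entries algebra_simps)
      then have MC: "trace (M ** com A B) = 0" using FC[OF t] F by simp
      \<comment> \<open>Otherwise \<open>M\<close> is orthogonal to \<open>A\<close>,
        \<open>B\<close> and their bracket, and the dual basis expansion gives
        \<open>M = 0\<close>.\<close>
      have MA: "trace (M ** A) \<noteq> 0"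
      proof
        assume "trace (M ** A) = 0"
        then have "M $ i $ j = 0" for i j
          using dual_basis_expansion[OF trA trB tM, of i j] MB MC CC by simp
        then show False using M0 by (simp add: vec_eq_iff)
      qed
      \<comment> \<open>The triple product identity with \<open>A\<close> and \<open>B\<close>
        exchanged, applied to the vanishing second derivative.\<close>
      have "trace (A ** ?Z) * trace (M ** B) * 2 = 2 * trace (B ** ?Z) * trace (M ** A)"
        using com_com[OF trB trA trZ, of M] elim t F MB by simp
      then have "trace (B ** ?Z) = 0" using MA MB by simp
      then show "trace (B ** A) + u t *\<^sub>R trace (B ** B) = 0"
        by (simp add: mat_entries algebra_simps)
    qed
  qed
qed

theorem theorem3p3:
  fixes A B :: cmat
  assumes "A \<in> su11" and "B \<in> su11" and "controllable A B"
  shows "(ip B (adj B) \<noteq> 0 \<longrightarrow>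
            (\<forall>u T X. abnormal_extremal A B u T X \<longrightarrow>
               (AE t in lborel. t \<in> {0..T} \<longrightarrow>
                  complex_of_real (u t) = - ip A (adj B) / ip B (adj B))))
       \<and> (ip B (adj B) = 0 \<longrightarrow> \<not> (\<exists>u T X. abnormal_extremal A B u T X))"
proof -
  note CC = controllable_imp_trace_com_ne_0[OF assms]
  note key = abnormal_extremal_condition[OF assms(1,2) CC]
  have ip: "ip M (adj B) = 2 * trace (B ** M)" for M
    unfolding ip_def adj_adj trace_mul_sym[of M] ..
  have "AE t in lborel. t \<in> {0..T} \<longrightarrow> complex_of_real (u t) = - ip A (adj B) / ip B (adj B)"
    if "ip B (adj B) \<noteq> 0" "abnormal_extremal A B u T X" for u T X
    using key[OF that(2)]
  proof eventually_elim
    case (elim t)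
    have nz: "trace (B ** B) \<noteq> 0" using that(1) by (simp add: ip)
    show ?case
    proof
      assume "t \<in> {0..T}"
      then have "complex_of_real (u t) * trace (B ** B) = - trace (B ** A)"
        using elim by (simp add: scaleR_conv_of_real eq_neg_iff_add_eq_0 add.commute)
      then have "complex_of_real (u t) = - trace (B ** A) / trace (B ** B)"
        using nz by (simp only: eq_divide_eq) simp
      then show "complex_of_real (u t) = - ip A (adj B) / ip B (adj B)"
        by (simp add: ip)
    qed
  qed
  moreover have False if "ip B (adj B) = 0" "abnormal_extremal A B u T X" for u T X
  proof -
    have T: "T > 0" using that(2) by (simp add: abnormal_extremal_def)
    have "AE t in lborel. t \<in> {0..T} \<longrightarrow> trace (B ** A) = 0"
      using key[OF that(2)] that(1) by (simp add: ip)
    \<comment> \<open>A constant that is zero almost everywhere on an interval of positive length is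
      zero.\<close>
    from eq_0_if_AE_eq_0[OF T _ this, of 0] T have "trace (B ** A) = 0" by simp
    then have "trace (com A B ** com A B) = 0"
      using that(1) trace_com_com[OF trace_su11 trace_su11, OF assms(1,2)]
      by (simp add: ip trace_mul_sym[of A B])
    with CC show False by simp
  qed
  ultimately show ?thesis by blast
qed

end
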